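(* Let $\mathbf{d}$ be a dissimilarity on $[0,1)$ that is continuous and strict circular Robinson and satisfies the bi-Lipschitz condition: there exist $L\ge\ell>0$ with $\ell\cdot\operatorname{Arc}(s,t)\le\mathbf{d}(s,t)\le L\cdot\operatorname{Arc}(s,t)$ for all $s,t\in[0,1)$. Let $x_0,\dots,x_{n-1}$ be i.i.d. uniform on $[0,1)$ and let $D_n$ be the $n\times n$ matrix $D_n(i,j)=\mathbf{d}(x_i,x_j)$. Then $$\mathbb{E}\big[\operatorname{diam}(S_{\mathcal{C}_R^*}(D_n))\big]=\mathcal{O}\Big(\frac{L+\ell}{\ell}\cdot\frac{\log n}{n}\Big).$$
   Context: $[0,1)$ is identified with the unit circle (so $0\sim1$), with its topology and natural cyclic order; points $x,y,z,w$ are cyclically ordered if pairwise distinct and $(y-x\bmod1)<(z-x\bmod1)<(w-x\bmod1)$. A dissimilarity is a nonnegative symmetric function vanishing on the diagonal; $\mathbf{d}$ is strict circular Robinson if $\mathbf{d}(y,w)>\min\{\mathbf{d}(y,x),\mathbf{d}(y,z)\}$ for all cyclically ordered $x,y,z,w$. $\operatorname{Arc}(s,t)=\min\{|s-t|,1-|s-t|\}$. For $[n]=\{0,\dots,n-1\}$, indices $i,j,k,l$ are cyclically ordered if pairwise distinct with $(j-i\bmod n)<(k-i\bmod n)<(l-i\bmod n)$; an $n\times n$ dissimilarity matrix $A$ is strict circular Robinson if $A(i,k)>\min\{A(j,k),A(k,l)\}$ for all cyclically ordered $i,j,k,l$. $S_{\mathcal{C}_R^*}(D)$ is the set of permutations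 $\sigma$ of $[n]$ such that the matrix $A$ with $A(\sigma(a),\sigma(b))=D(a,b)$ is strict circular Robinson. The Kendall-tau distance is $\tau_K(\pi_1,\pi_2)=|\mathcal{G}(\pi_1,\pi_2)|/\binom n2$, where $\mathcal{G}(\pi_1,\pi_2)$ is the set of pairs $i<j$ with $\pi_1(i)<\pi_1(j)$ and $\pi_2(i)>\pi_2(j)$, or $\pi_1(i)>\pi_1(j)$ and $\pi_2(i)<\pi_2(j)$. $\operatorname{Dih}_n$ is the group generated by $i\mapsto n-1-i$ and $i\mapsto i+1\bmod n$. For $S$ a set of permutations of $[n]$, $\operatorname{diam}(S)=\max_{\pi_1,\pi_2\in S}\min_{\hat\pi_1\in\operatorname{Dih}_n\circ\pi_1}\tau_K(\hat\pi_1,\pi_2)$, where $\operatorname{Dih}_n\circ\pi_1=\{\rho\circ\pi_1:\rho\in\operatorname{Dih}_n\}$. The asymptotics are as $n\to\infty$. *)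

theory Defs
  imports
    "HOL-Probability.Probability"
    "HOL-Combinatorics.Permutations"
    "HOL-Algebra.Generated_Groups"
begin

definition dissimilarity_on :: "'a set \<Rightarrow> ('a \<Rightarrow> 'a \<Rightarrow> real) \<Rightarrow> bool" where
  "dissimilarity_on S d \<longleftrightarrow>
     (\<forall>x\<in>S. \<forall>y\<in>S. d x y \<ge> 0 \<and> d x y = d y x) \<and> (\<forall>x\<in>S. d x x = 0)"

text \<open>The interval \<open>[0,1)\<close> carries the topology of the unit circle, transported along
  \<open>t \<mapsto> exp (2 \<pi> \<i> t)\<close>; points near \<open>1\<close> are close to \<open>0\<close>.\<close>

definition circle_topology :: "real topology" where
  "circle_topology = pullback_topology {0..<1} (\<lambda>t. cis (2 * pi * t)) euclidean"

definition continuous_on_circle :: "(real \<Rightarrow> real \<Rightarrow> real) \<Rightarrow> bool" where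
  "continuous_on_circle d \<longleftrightarrow>
     continuous_map (prod_topology circle_topology circle_topology) euclidean (\<lambda>(s, t). d s t)"

definition Arc :: "real \<Rightarrow> real \<Rightarrow> real" where
  "Arc s t = min \<bar>s - t\<bar> (1 - \<bar>s - t\<bar>)"

definition bi_lipschitz_Arc :: "real \<Rightarrow> real \<Rightarrow> (real \<Rightarrow> real \<Rightarrow> real) \<Rightarrow> bool" where
  "bi_lipschitz_Arc l L d \<longleftrightarrow>
     (\<forall>s\<in>{0..<1}. \<forall>t\<in>{0..<1}. l * Arc s t \<le> d s t \<and> d s t \<le> L * Arc s t)"

definition cyclically_ordered :: "real \<Rightarrow> real \<Rightarrow> real \<Rightarrow> real \<Rightarrow> bool" where
  "cyclically_ordered x y z w \<longleftrightarrow>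
     distinct [x, y, z, w] \<and> frac (y - x) < frac (z - x) \<and> frac (z - x) < frac (w - x)"

definition strict_circular_robinson :: "(real \<Rightarrow> real \<Rightarrow> real) \<Rightarrow> bool" where
  "strict_circular_robinson d \<longleftrightarrow>
     (\<forall>x\<in>{0..<1}. \<forall>y\<in>{0..<1}. \<forall>z\<in>{0..<1}. \<forall>w\<in>{0..<1}.
        cyclically_ordered x y z w \<longrightarrow> d y w > min (d y x) (d y z))"

definition cyclically_ordered_mod :: "nat \<Rightarrow> nat \<Rightarrow> nat \<Rightarrow> nat \<Rightarrow> nat \<Rightarrow> bool" where
  "cyclically_ordered_mod n i j k l \<longleftrightarrow>
     distinct [i, j, k, l] \<and>
     (int j - int i) mod int n < (int k - int i) mod int n \<and>
     (int k - int i) mod int n < (int l - int i) mod int n"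

text \<open>An \<open>n \<times> n\<close> matrix is a function of two indices, of which only the values at indices
  below \<open>n\<close> matter.\<close>

definition strict_circular_robinson_matrix :: "nat \<Rightarrow> (nat \<Rightarrow> nat \<Rightarrow> real) \<Rightarrow> bool" where
  "strict_circular_robinson_matrix n A \<longleftrightarrow>
     dissimilarity_on {..<n} A \<and>
     (\<forall>i<n. \<forall>j<n. \<forall>k<n. \<forall>l<n.
        cyclically_ordered_mod n i j k l \<longrightarrow> A i k > min (A j k) (A k l))"

definition robinson_orderings :: "nat \<Rightarrow> (nat \<Rightarrow> nat \<Rightarrow> real) \<Rightarrow> (nat \<Rightarrow> nat) set" where
  "robinson_orderings n D =
     {\<sigma>. \<sigma> permutes {..<n} \<and>
          (\<exists>A. (\<forall>a<n. \<forall>b<n. A (\<sigma> a) (\<sigma> b) = D a b) \<and> strict_circular_robinson_matrix n A)}"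

definition kendall_tau :: "nat \<Rightarrow> (nat \<Rightarrow> nat) \<Rightarrow> (nat \<Rightarrow> nat) \<Rightarrow> real" where
  "kendall_tau n p q =
     real (card {(i, j). i < j \<and> j < n \<and> (p i < p j \<and> q i > q j \<or> p i > p j \<and> q i < q j)})
       / real (n choose 2)"

definition permutation_group :: "nat \<Rightarrow> (nat \<Rightarrow> nat) monoid" where
  "permutation_group n = \<lparr>carrier = {p. p permutes {..<n}}, mult = (\<circ>), one = id\<rparr>"

definition reflection :: "nat \<Rightarrow> nat \<Rightarrow> nat" where
  "reflection n i = (if i < n then n - 1 - i else i)"

definition rotation :: "nat \<Rightarrow> nat \<Rightarrow> nat" where
  "rotation n i = (if i < n then (i + 1) mod n else i)"

definition Dih :: "nat \<Rightarrow> (nat \<Rightarrow> nat) set" where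
  "Dih n = generate (permutation_group n) {reflection n, rotation n}"

text \<open>The maximum is not defined for empty \<open>S\<close>; that case is set to \<open>0\<close>. For the random
  matrices considered it has probability \<open>0\<close>, because sampled points are almost surely distinct
  and sorting distinct points gives an element of \<^const>\<open>robinson_orderings\<close>.\<close>

definition diam :: "nat \<Rightarrow> (nat \<Rightarrow> nat) set \<Rightarrow> real" where
  "diam n S = (if S = {} then 0 else
     Max {Min {kendall_tau n (\<rho> \<circ> \<pi>\<^sub>1) \<pi>\<^sub>2 | \<rho>. \<rho> \<in> Dih n} | \<pi>\<^sub>1 \<pi>\<^sub>2. \<pi>\<^sub>1 \<in> S \<and> \<pi>\<^sub>2 \<in> S})"

text \<open>The uniform distribution on \<open>[0,1)\<close>, as a measure whose underlying space is \<open>[0,1)\<close>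
  itself, so that the random points lie in \<open>[0,1)\<close> everywhere and not just almost surely.\<close>

definition uniform01 :: "real measure" where
  "uniform01 = restrict_space lborel {0..<1}"

definition iid_uniform01 :: "'a measure \<Rightarrow> nat \<Rightarrow> (nat \<Rightarrow> 'a \<Rightarrow> real) \<Rightarrow> bool" where
  "iid_uniform01 M n x \<longleftrightarrow>
     prob_space M \<and>
     prob_space.indep_vars M (\<lambda>_. uniform01) x {..<n} \<and>
     (\<forall>i<n. distr M uniform01 (x i) = uniform01)"

end

theory Submission
  imports Defs
begin

text \<open>In a Robinson ordering every ball of \<open>d\<close> is an arc. Cut \<open>[0,1)\<close> into
  \<open>m \<approx> n / (2 log n)\<close> cells; with high probability every cell is occupied and none holds more
  than \<open>10 log n\<close> points. By the bi-Lipschitz bound, the ball of radius \<open>2L/m\<close> around a sample point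
  contains all points of the same and the neighbouring cells, but no point more than
  \<open>h = \<lceil>2L/l\<rceil>\<close> cells away. Walking from cell to cell, the ordering therefore
  cannot jump over a point that is more than \<open>h\<close> cells away from the walk, so it preserves or
  reverses the order of all pairs that are more than \<open>h\<close> cells apart and more than about
  \<open>2h\<close> cells away from the point \<open>p\<close> at position \<open>0\<close>. Two orderings with the same \<open>p\<close> and the same orientation, which
  can be arranged by a dihedral symmetry, hence disagree only on the \<open>O(n h log n)\<close> remaining pairs.\<close>

section \<open>Robinson orderings and the cyclic order of positions\<close>

text \<open>The Robinson inequality pulled back to sample indices, with no matrix \<open>A\<close>.
  As \<open>q\<close> is an arbitrary function, it applies directly to shifts such as
  \<open>(q a + s) mod n\<close>.\<close>

definition respects_cyclic_order :: "nat \<Rightarrow> (nat \<Rightarrow> nat \<Rightarrow> real) \<Rightarrow> (nat \<Rightarrow> nat) \<Rightarrow> bool" where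
  "respects_cyclic_order n D q \<longleftrightarrow>
     (\<forall>a<n. \<forall>b<n. \<forall>c<n. \<forall>e<n.
        cyclically_ordered_mod n (q a) (q b) (q c) (q e) \<longrightarrow> D a c > min (D b c) (D c e))"

lemma robinson_orderings_respects:
  assumes "\<sigma> \<in> robinson_orderings n D"
  shows "\<sigma> permutes {..<n}" "respects_cyclic_order n D \<sigma>"
proof -
  show p: "\<sigma> permutes {..<n}"
    using assms by (auto simp: robinson_orderings_def)
  obtain A where A: "\<forall>a<n. \<forall>b<n. A (\<sigma> a) (\<sigma> b) = D a b" "strict_circular_robinson_matrix n A"
    using assms by (auto simp: robinson_orderings_def)
  have lt: "\<sigma> a < n" if "a < n" for a
    using permutes_in_image[OF p, of a] that by simp
  show "respects_cyclic_order n D \<sigma>"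
    unfolding respects_cyclic_order_def
  proof (intro allI impI)
    fix a b c e
    assume *: "a < n" "b < n" "c < n" "e < n"
      and co: "cyclically_ordered_mod n (\<sigma> a) (\<sigma> b) (\<sigma> c) (\<sigma> e)"
    have "A (\<sigma> a) (\<sigma> c) > min (A (\<sigma> b) (\<sigma> c)) (A (\<sigma> c) (\<sigma> e))"
      using A(2) lt * co by (auto simp: strict_circular_robinson_matrix_def)
    then show "D a c > min (D b c) (D c e)"
      using A(1) * by simp
  qed
qed

text \<open>Cyclic order depends only on differences of positions modulo \<open>n\<close>, and a
  common shift cancels in them.\<close>

lemma cyclically_ordered_mod_shift:
  assumes "cyclically_ordered_mod n ((i + s) mod n) ((j + s) mod n) ((k + s) mod n) ((l + s) mod n)"
  shows "cyclically_ordered_mod n i j k l"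
proof -
  have "(int ((b + s) mod n) - int ((a + s) mod n)) mod int n = (int b - int a) mod int n" for a b
    by (simp add: zmod_int mod_diff_eq)
  then show ?thesis
    using assms unfolding cyclically_ordered_mod_def by auto
qed

lemma respects_cyclic_order_shift:
  assumes "respects_cyclic_order n D q"
  shows "respects_cyclic_order n D (\<lambda>a. (q a + s) mod n)"
  using assms cyclically_ordered_mod_shift unfolding respects_cyclic_order_def by blast

text \<open>Seen from the largest position \<open>l\<close>, every smaller \<open>a\<close> is
  reached only after the wrap-around, at distance \<open>n + a - l\<close>, so the smaller positions
  keep their natural order. This and the next lemma bring in the element at position
  \<open>0\<close> as one of the four points.\<close>

lemma cyclically_ordered_mod_zero_second:
  assumes "0 < j" "j < k" "k < l" "l < n"
  shows "cyclically_ordered_mod n l 0 j k"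
proof -
  have "(int a - int l) mod int n = int n + int a - int l" if "a < l" for a
    using that \<open>l < n\<close> by (intro int_mod_pos_eq[where q = "-1"]) auto
  from this[of 0] this[of j] this[of k] show ?thesis
    using assms by (auto simp: cyclically_ordered_mod_def)
qed

lemma cyclically_ordered_mod_zero_last:
  assumes "0 < i" "i < j" "j < k" "k < n"
  shows "cyclically_ordered_mod n i j k 0"
proof -
  have "(0 - int i) mod int n = int n - int i"
    using assms by (intro int_mod_pos_eq[where q = "-1"]) auto
  then show ?thesis
    using assms by (auto simp: cyclically_ordered_mod_def)
qed

text \<open>The ball of radius \<open>r\<close> around \<open>i\<close> is an arc of the ordering; as it misses the element \<open>p\<close>
  at position \<open>0\<close>, it is an interval of positions.\<close>

lemma ball_not_between:
  assumes resp: "respects_cyclic_order n D q"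
    and sym: "\<And>a b. a < n \<Longrightarrow> b < n \<Longrightarrow> D a b = D b a"
    and lt: "\<And>a. a < n \<Longrightarrow> q a < n" and inj: "inj_on q {..<n}"
    and ijwp: "i < n" "j < n" "w < n" "p < n" "q p = 0"
    and ball: "D i j \<le> r" "D i w > r" "D i p > r" "i \<noteq> p"
  shows "\<not> (q i < q w \<and> q w < q j)" "\<not> (q j < q w \<and> q w < q i)"
proof -
  have "j \<noteq> p"
    using ball by auto
  with \<open>i \<noteq> p\<close> have pos: "q i > 0" "q j > 0"
    using inj ijwp by (metis gr0I inj_onD lessThan_iff)+
  have D: "D a c > min (D b c) (D c e)"
    if "cyclically_ordered_mod n (q a) (q b) (q c) (q e)" "a < n" "b < n" "c < n" "e < n" for a b c e
    using resp that unfolding respects_cyclic_order_def by blast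
  show "\<not> (q i < q w \<and> q w < q j)"
  proof
    assume "q i < q w \<and> q w < q j"
    \<comment> \<open>Here \<open>p\<close> and \<open>w\<close> separate \<open>i\<close> from
      \<open>j\<close>: the Robinson inequality gives \<open>D j i > min (D p i) (D i w)\<close>,
      which exceeds \<open>r\<close>. The other case exchanges \<open>p\<close> and
      \<open>w\<close>.\<close>
    then have "cyclically_ordered_mod n (q j) (q p) (q i) (q w)"
      using cyclically_ordered_mod_zero_second[of "q i" "q w" "q j" n] pos lt ijwp by simp
    from D[OF this] show False
      using ball sym[of i j] sym[of i p] ijwp by auto
  qed
  show "\<not> (q j < q w \<and> q w < q i)"
  proof
    assume *: "q j < q w \<and> q w < q i"
    then have "cyclically_ordered_mod n (q j) (q w) (q i) (q p)"
      using pos lt ijwp cyclically_ordered_mod_zero_last[of "q j" "q w" "q i" n] by simp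
    from D[OF this] show False
      using ball sym[of i j] sym[of i w] ijwp by auto
  qed
qed

section \<open>How an ordering runs through the cells\<close>

text \<open>Here \<open>t i\<close> is the cell of the \<open>i\<close>-th point, counted cyclically from the cell of \<open>p\<close>.\<close>

locale circular_cells =
  fixes n :: nat and D :: "nat \<Rightarrow> nat \<Rightarrow> real" and r :: real
    and p :: nat and t :: "nat \<Rightarrow> int" and m h :: int
  assumes D_sym: "\<And>a b. a < n \<Longrightarrow> b < n \<Longrightarrow> D a b = D b a"
    and p: "p < n" "t p = 0"
    and h: "h \<ge> 0"
    and t_range: "\<And>i. i < n \<Longrightarrow> 0 \<le> t i \<and> t i < m"
    and t_surj: "\<And>s. 0 \<le> s \<Longrightarrow> s < m \<Longrightarrow> \<exists>i<n. t i = s"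
    and near: "\<And>i j. i < n \<Longrightarrow> j < n \<Longrightarrow> \<bar>t i - t j\<bar> \<le> 1 \<Longrightarrow> D i j \<le> r"
    and far: "\<And>i j. i < n \<Longrightarrow> j < n \<Longrightarrow> h < \<bar>t i - t j\<bar> \<Longrightarrow> \<bar>t i - t j\<bar> < m - h \<Longrightarrow> D i j > r"
begin

text \<open>The margins leave more than \<open>h\<close> cells between the pair and the reference
  points of \<open>order_good_pair\<close>, which lie in cells \<open>h + 1\<close> and
  \<open>m - h - 1\<close> to be far from \<open>p\<close> themselves.\<close>

definition good_pair :: "nat \<Rightarrow> nat \<Rightarrow> bool" where
  "good_pair u v \<longleftrightarrow> 2 * h + 1 < t u \<and> t u + h < t v \<and> t v < m - 2 * h - 1"

end

locale circular_cells_ordering = circular_cells +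
  fixes q :: "nat \<Rightarrow> nat"
  assumes q_inj: "inj_on q {..<n}" and q_lt: "\<And>a. a < n \<Longrightarrow> q a < n"
    and q_p: "q p = 0" and q_resp: "respects_cyclic_order n D q"
begin

lemma q_eq_iff: "a < n \<Longrightarrow> b < n \<Longrightarrow> q a = q b \<longleftrightarrow> a = b"
  using q_inj by (auto simp: inj_on_def)

text \<open>The ball of radius \<open>r\<close> around \<open>i\<close> contains \<open>j\<close>
  but neither \<open>w\<close> nor \<open>p\<close>, so \<open>w\<close> cannot lie between
  \<open>i\<close> and \<open>j\<close>.\<close>

lemma same_side_step:
  assumes "i < n" "j < n" "w < n" "\<bar>t i - t j\<bar> \<le> 1"
    and "h < t i" "t i < m - h" "h < \<bar>t i - t w\<bar>" "\<bar>t i - t w\<bar> < m - h"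
  shows "q i < q w \<longleftrightarrow> q j < q w"
proof -
  have 1: "D i j \<le> r" "D i w > r" "D i p > r"
    using near far[of i w] far[of i p] p assms h by auto
  then have "w \<noteq> j" by auto
  moreover have "w \<noteq> i" "i \<noteq> p" using assms h p by auto
  ultimately show ?thesis
    using ball_not_between[OF q_resp D_sym q_lt q_inj, where i=i and j=j and w=w and p=p and r=r]
      1 assms p q_p q_eq_iff by (meson linorder_less_linear)
qed

text \<open>No cell is empty, so one can walk from \<open>u\<close> to \<open>v\<close> through
  consecutive cells; all of them are more than \<open>h\<close> cells from those of \<open>w\<close>
  and \<open>p\<close>, so no step crosses \<open>w\<close>.\<close>

lemma same_side:
  assumes "u < n" "v < n" "w < n" "t u \<le> t v"
    and "h < t u" "t v < m - h" "h < t w" "t w < m - h"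
    and "t v + h < t w \<or> t w + h < t u"
  shows "q u < q w \<longleftrightarrow> q v < q w"
proof -
  have "\<forall>i<n. t i = s \<longrightarrow> (q u < q w \<longleftrightarrow> q i < q w)" if "t u \<le> s" "s \<le> t v" for s
    using that
  proof (induction s rule: int_ge_induct)
    case base
    have "q u < q w \<longleftrightarrow> q i < q w" if "i < n" "t i = t u" for i
      by (rule same_side_step) (use assms h that in linarith)+
    then show ?case by blast
  next
    case (step s)
    have "0 \<le> s" "s < m"
      using step t_range[OF assms(1)] t_range[OF assms(2)] by linarith+
    then obtain j where j: "j < n" "t j = s"
      using t_surj by blast
    have "q j < q w \<longleftrightarrow> q i < q w" if "i < n" "t i = s + 1" for i
      by (rule same_side_step) (use assms h j that step.hyps step.prems in linarith)+
    moreover have "q u < q w \<longleftrightarrow> q j < q w"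
      using step.IH step.prems j by simp
    ultimately show ?case by blast
  qed
  then show ?thesis using assms by simp
qed

text \<open>The walk from \<open>u\<close> to \<open>v\<close> stays away from \<open>w\<close>, and
  the walk from \<open>v\<close> to \<open>w\<close> stays away from \<open>u\<close>. Together,
  three well separated points are met in increasing or in decreasing order of their cells.\<close>

lemma order_separated:
  assumes "u < n" "v < n" "w < n" "h < t u" "t u + h < t v" "t v + h < t w" "t w < m - h"
  shows "q u < q w \<longleftrightarrow> q v < q w" "q u < q v \<longleftrightarrow> q u < q w"
proof -
  show "q u < q w \<longleftrightarrow> q v < q w"
    using same_side[of u v w] assms h by simp
  have "q v < q u \<longleftrightarrow> q w < q u"
    using same_side[of v w u] assms h by simp
  moreover have "u \<noteq> v" "u \<noteq> w" using assms h by auto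
  ultimately show "q u < q v \<longleftrightarrow> q u < q w"
    using q_eq_iff[of u v] q_eq_iff[of u w] assms by auto
qed

text \<open>Replacing \<open>v\<close> by \<open>c\<close> and then \<open>u\<close> by
  \<open>a\<close> does not change the comparison, so the single pair \<open>a\<close>,
  \<open>c\<close> fixes the orientation of all good pairs.\<close>

lemma order_good_pair:
  assumes "a < n" "c < n" "t a = h + 1" "t c = m - h - 1"
    and "u < n" "v < n" "good_pair u v"
  shows "q u < q v \<longleftrightarrow> q a < q c"
  using order_separated[of a u v] order_separated[of a u c] order_separated[of a v c] 
    assms h unfolding good_pair_def by auto

lemma good_pair_monotone:
  "(\<forall>u<n. \<forall>v<n. good_pair u v \<longrightarrow> q u < q v) \<or> (\<forall>u<n. \<forall>v<n. good_pair u v \<longrightarrow> q v < q u)"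
\<comment> \<open>With this many cells, \<open>h + 1\<close> and \<open>m - h - 1\<close> are valid
  cell numbers; with fewer, the margins exclude every good pair.\<close>
proof (cases "2 * h + 2 < m")
  case True
  then obtain a c where ac: "a < n" "c < n" "t a = h + 1" "t c = m - h - 1"
    using t_surj[of "h + 1"] t_surj[of "m - h - 1"] h by auto
  have "q u < q v \<longleftrightarrow> q a < q c" "u \<noteq> v" if "u < n" "v < n" "good_pair u v" for u v
    using order_good_pair[OF ac that] that h by (auto simp: good_pair_def)
  then show ?thesis
    using q_eq_iff by (metis linorder_less_linear)
next
  case False
  then have "\<not> good_pair u v" for u v
    using h by (auto simp: good_pair_def)
  then show ?thesis by simp
qed

end

section \<open>Counting the pairs that are not good\<close>

context circular_cells
begin

definition bad_pairs :: "(nat \<times> nat) set" where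
  "bad_pairs = {(i, j). i < n \<and> j < n \<and> \<not> good_pair i j \<and> \<not> good_pair j i}"

text \<open>\<open>S\<close> may reach outside the range of cell numbers, where fibres are empty, so
  windows around a cell need no truncation.\<close>

lemma card_fibres_le:
  fixes K :: real
  assumes "finite S" "\<And>s. 0 \<le> s \<Longrightarrow> s < m \<Longrightarrow> real (card {i. i < n \<and> t i = s}) \<le> K" "0 \<le> K"
  shows "real (card {i. i < n \<and> t i \<in> S}) \<le> real (card S) * K"
proof -
  have "{i. i < n \<and> t i \<in> S} = (\<Union>s\<in>S. {i. i < n \<and> t i = s})" by auto
  then have "real (card {i. i < n \<and> t i \<in> S}) \<le> (\<Sum>s\<in>S. real (card {i. i < n \<and> t i = s}))"
    using card_UN_le[OF assms(1), of "\<lambda>s. {i. i < n \<and> t i = s}"]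
    by (simp flip: of_nat_sum)
  also have "\<dots> \<le> (\<Sum>s\<in>S. K)"
  proof (rule sum_mono)
    fix s
    show "real (card {i. i < n \<and> t i = s}) \<le> K"
    proof (cases "0 \<le> s \<and> s < m")
      case False
      then have "{i. i < n \<and> t i = s} = {}" using t_range by blast
      then have "card {i. i < n \<and> t i = s} = 0" by (simp only: card.empty)
      then show ?thesis using assms(3) by linarith
    qed (use assms(2) in blast)
  qed
  finally show ?thesis by simp
qed

text \<open>A bad pair has a member in \<open>E\<close>, the points in at most
  \<open>4 * h + 3\<close> cells around \<open>p\<close>, or its cells differ by at most
  \<open>h\<close>. The factor is \<open>2 * (4 * h + 3) + (2 * h + 1)\<close>.\<close>

lemma card_bad_pairs:
  fixes K :: real
  assumes K: "\<And>s. 0 \<le> s \<Longrightarrow> s < m \<Longrightarrow> real (card {i. i < n \<and> t i = s}) \<le> K" "0 \<le> K"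
  shows "real (card bad_pairs) \<le> n * ((10 * h + 7) * K)"
proof -
  define E where "E = {i. i < n \<and> t i \<in> {0..2 * h + 1} \<union> {m - 2 * h - 1..m - 1}}"
  define F where "F i = {j. j < n \<and> t j \<in> {t i - h..t i + h}}" for i
  have "card ({0..2 * h + 1} \<union> {m - 2 * h - 1..m - 1}) \<le> nat (4 * h + 3)"
    by (rule order_trans[OF card_Un_le]) (use h in auto)
  then have "real (card ({0..2 * h + 1} \<union> {m - 2 * h - 1..m - 1})) \<le> 4 * h + 3"
    using h by linarith
  then have E: "real (card E) \<le> (4 * h + 3) * K"
    unfolding E_def
    using card_fibres_le[OF _ K, of "{0..2 * h + 1} \<union> {m - 2 * h - 1..m - 1}"] K(2)
    by (smt (verit) finite_Un finite_atLeastAtMost_int mult_right_mono)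
  have F: "real (card (F i)) \<le> (2 * h + 1) * K" for i
    unfolding F_def using card_fibres_le[OF _ K, of "{t i - h..t i + h}"] h by simp
  have fin: "finite E" "finite (F i)" for i by (auto simp: E_def F_def)
  have "bad_pairs \<subseteq> E \<times> {..<n} \<union> ({..<n} \<times> E \<union> Sigma {..<n} F)"
  proof (rule subrelI)
    fix i j assume "(i, j) \<in> bad_pairs"
    then show "(i, j) \<in> E \<times> {..<n} \<union> ({..<n} \<times> E \<union> Sigma {..<n} F)"
      using t_range[of i] t_range[of j]
      by (auto simp: bad_pairs_def good_pair_def E_def F_def)
  qed
  then have "card bad_pairs \<le> card (E \<times> {..<n} \<union> ({..<n} \<times> E \<union> Sigma {..<n} F))"
    using fin by (intro card_mono) auto
  also have "\<dots> \<le> card (E \<times> {..<n}) + (card ({..<n} \<times> E) + card (Sigma {..<n} F))"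
    using card_Un_le by (meson add_left_mono order_trans)
  finally have "real (card bad_pairs) \<le> n * real (card E) + (n * real (card E) + (\<Sum>i<n. real (card (F i))))"
    using fin by (simp add: card_cartesian_product mult.commute flip: of_nat_mult of_nat_add of_nat_sum)
  also have "\<dots> \<le> n * ((4 * h + 3) * K) + (n * ((4 * h + 3) * K) + (\<Sum>i<n. (2 * h + 1) * K))"
    by (intro add_mono mult_left_mono E sum_mono F) auto
  also have "\<dots> = n * ((10 * h + 7) * K)"
    by (simp add: algebra_simps)
  finally show ?thesis .
qed

end

section \<open>The dihedral group, the Kendall-tau distance and the diameter\<close>

lemma group_permutation_group: "group (permutation_group n)"
proof (rule groupI)
  fix p assume "p \<in> carrier (permutation_group n)"
  then have p: "p permutes {..<n}" by (simp add: permutation_group_def)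
  show "\<exists>y\<in>carrier (permutation_group n).
      y \<otimes>\<^bsub>permutation_group n\<^esub> p = \<one>\<^bsub>permutation_group n\<^esub>"
    using permutes_inv[OF p] permutes_inv_o(2)[OF p]
    by (auto simp: permutation_group_def)
qed (auto simp: permutation_group_def permutes_compose permutes_id comp_assoc)

lemma reflection_permutes: "reflection n permutes {..<n}"
  by (rule bij_imp_permutes)
    (auto simp: reflection_def intro!: bij_betw_byWitness[where f' = "reflection n"])

lemma rotation_permutes: "rotation n permutes {..<n}"
proof (rule bij_imp_permutes)
  have inj: "inj_on (rotation n) {..<n}"
    by (auto simp: inj_on_def rotation_def mod_Suc split: if_splits)
  moreover have "rotation n ` {..<n} \<subseteq> {..<n}"
    by (auto simp: rotation_def)
  ultimately show "bij_betw (rotation n) {..<n} {..<n}"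
    by (simp add: bij_betw_def endo_inj_surj)
qed (simp add: rotation_def)

lemma Dih_permutes: "\<rho> \<in> Dih n \<Longrightarrow> \<rho> permutes {..<n}"
  using group.generate_incl[OF group_permutation_group, of "{reflection n, rotation n}" n]
    reflection_permutes rotation_permutes
  by (auto simp: Dih_def permutation_group_def)

lemma finite_Dih: "finite (Dih n)"
  using Dih_permutes by (intro finite_subset[OF _ finite_permutations[of "{..<n}"]]) auto

lemma id_in_Dih: "id \<in> Dih n"
  using generate.one[of "permutation_group n"] by (simp add: Dih_def permutation_group_def)

lemma comp_in_Dih: "\<rho> \<in> Dih n \<Longrightarrow> \<rho>' \<in> Dih n \<Longrightarrow> \<rho> \<circ> \<rho>' \<in> Dih n"
  using generate.eng[of \<rho> "permutation_group n" _ \<rho>'] by (simp add: Dih_def permutation_group_def)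

lemma reflection_in_Dih: "reflection n \<in> Dih n"
  and rotation_in_Dih: "rotation n \<in> Dih n"
  by (auto simp: Dih_def intro: generate.incl)

lemma rotation_funpow_in_Dih: "rotation n ^^ k \<in> Dih n"
proof (induction k)
  case (Suc k)
  then show ?case
    unfolding funpow.simps by (rule comp_in_Dih[OF rotation_in_Dih])
qed (simp add: id_in_Dih flip: id_def)

lemma rotation_funpow: "i < n \<Longrightarrow> (rotation n ^^ k) i = (i + k) mod n"
  by (induction k) (auto simp: rotation_def mod_Suc_eq)

text \<open>\<open>Max\<close> and \<open>Min\<close> range over finite sets because
  \<open>S\<close> and \<open>Dih n\<close> consist of permutations of \<open>{..<n}\<close>. The
  bound \<open>0 \<le> B\<close> covers empty \<open>S\<close>, where \<open>diam\<close> is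
  \<open>0\<close>.\<close>

lemma diam_le:
  assumes "S \<subseteq> {\<pi>. \<pi> permutes {..<n}}" "0 \<le> B"
    and "\<And>\<pi>\<^sub>1 \<pi>\<^sub>2. \<pi>\<^sub>1 \<in> S \<Longrightarrow> \<pi>\<^sub>2 \<in> S \<Longrightarrow> \<exists>\<rho>\<in>Dih n. kendall_tau n (\<rho> \<circ> \<pi>\<^sub>1) \<pi>\<^sub>2 \<le> B"
  shows "diam n S \<le> B"
proof (cases "S = {}")
  case False
  define mindist where "mindist \<pi>\<^sub>1 \<pi>\<^sub>2 = Min {kendall_tau n (\<rho> \<circ> \<pi>\<^sub>1) \<pi>\<^sub>2 | \<rho>. \<rho> \<in> Dih n}" for \<pi>\<^sub>1 \<pi>\<^sub>2
  have "finite S"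
    using assms(1) finite_permutations[of "{..<n}"] finite_subset by blast
  moreover have eq: "{mindist \<pi>\<^sub>1 \<pi>\<^sub>2 | \<pi>\<^sub>1 \<pi>\<^sub>2. \<pi>\<^sub>1 \<in> S \<and> \<pi>\<^sub>2 \<in> S} = (\<lambda>(\<pi>\<^sub>1, \<pi>\<^sub>2). mindist \<pi>\<^sub>1 \<pi>\<^sub>2) ` (S \<times> S)"
    by auto
  ultimately have fin: "finite {mindist \<pi>\<^sub>1 \<pi>\<^sub>2 | \<pi>\<^sub>1 \<pi>\<^sub>2. \<pi>\<^sub>1 \<in> S \<and> \<pi>\<^sub>2 \<in> S}"
    by simp
  have "mindist \<pi>\<^sub>1 \<pi>\<^sub>2 \<le> B" if \<pi>: "\<pi>\<^sub>1 \<in> S" "\<pi>\<^sub>2 \<in> S" for \<pi>\<^sub>1 \<pi>\<^sub>2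
  proof -
    obtain \<rho> where \<rho>: "\<rho> \<in> Dih n" "kendall_tau n (\<rho> \<circ> \<pi>\<^sub>1) \<pi>\<^sub>2 \<le> B"
      using assms(3)[OF \<pi>] by blast
    have "finite {kendall_tau n (\<rho> \<circ> \<pi>\<^sub>1) \<pi>\<^sub>2 | \<rho>. \<rho> \<in> Dih n}"
      using finite_Dih by simp
    then have "mindist \<pi>\<^sub>1 \<pi>\<^sub>2 \<le> kendall_tau n (\<rho> \<circ> \<pi>\<^sub>1) \<pi>\<^sub>2"
      unfolding mindist_def using \<rho>(1) by (intro Min_le) auto
    then show ?thesis using \<rho>(2) by linarith
  qed
  then have "Max {mindist \<pi>\<^sub>1 \<pi>\<^sub>2 | \<pi>\<^sub>1 \<pi>\<^sub>2. \<pi>\<^sub>1 \<in> S \<and> \<pi>\<^sub>2 \<in> S} \<le> B"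
    using False fin by (subst Max_le_iff) blast+
  then show ?thesis
    using False by (simp add: diam_def mindist_def)
qed (use assms in \<open>simp add: diam_def\<close>)

lemma kendall_tau_le_1: "kendall_tau n p q \<le> 1"
proof -
  let ?P = "{(i, j). i < j \<and> j < n \<and> (p i < p j \<and> q i > q j \<or> p i > p j \<and> q i < q j)}"
  have "card ?P \<le> card {A. A \<subseteq> {..<n} \<and> card A = 2}"
  proof (rule card_inj_on_le)
    show "inj_on (\<lambda>(i, j). {i, j}) ?P"
      by (auto simp: inj_on_def doubleton_eq_iff)
    show "(\<lambda>(i, j). {i, j}) ` ?P \<subseteq> {A. A \<subseteq> {..<n} \<and> card A = 2}"
      by (auto simp: card_insert_if)
    show "finite {A. A \<subseteq> {..<n} \<and> card A = 2}"
      by (rule finite_subset[of _ "Pow {..<n}"]) auto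
  qed
  also have "\<dots> = n choose 2"
    using n_subsets[of "{..<n}" 2] by simp
  finally have "card ?P \<le> n choose 2" .
  then show ?thesis
    unfolding kendall_tau_def by (simp add: divide_le_eq_1 le_less_linear)
qed

text \<open>The trivial bound, used for samples with an empty or an overfull cell.\<close>

lemma diam_robinson_orderings_le_1: "diam n (robinson_orderings n D) \<le> 1"
  by (intro diam_le bexI[OF kendall_tau_le_1 id_in_Dih]) (auto simp: robinson_orderings_def)

lemma real_choose_two: "real (n choose 2) = real n * (real n - 1) / 2"
proof -
  have "2 dvd n * (n - 1)" by auto
  then show ?thesis
    by (cases n) (simp_all add: choose_two real_of_nat_div algebra_simps)
qed

text \<open>Rotating \<open>\<pi>\<^sub>1\<close> so that \<open>p\<close> comes first, and reflecting it about \<open>p\<close> if needed, makes it agree with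
  \<open>\<pi>\<^sub>2\<close> on all good pairs.\<close>

lemma (in circular_cells) kendall_tau_rotated_le:
  fixes K :: real
  assumes n: "2 \<le> n"
    and K: "\<And>s. 0 \<le> s \<Longrightarrow> s < m \<Longrightarrow> real (card {i. i < n \<and> t i = s}) \<le> K" "0 \<le> K"
    and \<pi>: "\<pi>\<^sub>1 \<in> robinson_orderings n D" "\<pi>\<^sub>2 \<in> robinson_orderings n D" "\<pi>\<^sub>2 p = 0"
  shows "\<exists>\<rho>\<in>Dih n. kendall_tau n (\<rho> \<circ> \<pi>\<^sub>1) \<pi>\<^sub>2 \<le> 2 * (10 * h + 7) * K / (real n - 1)"
proof -
  note per1 = robinson_orderings_respects(1)[OF \<pi>(1)] and per2 = robinson_orderings_respects(1)[OF \<pi>(2)]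
  have lt1: "\<pi>\<^sub>1 a < n" if "a < n" for a
    using permutes_in_image[OF per1, of a] that by simp
  have lt2: "\<pi>\<^sub>2 a < n" if "a < n" for a
    using permutes_in_image[OF per2, of a] that by simp
  \<comment> \<open>Rotating by \<open>k\<close> moves \<open>p\<close> from position
    \<open>\<pi>\<^sub>1 p\<close> to \<open>n mod n = 0\<close>.\<close>
  define k where "k = n - \<pi>\<^sub>1 p"
  define rot where "rot = rotation n ^^ k"
  have rot: "rot \<in> Dih n" by (simp add: rot_def rotation_funpow_in_Dih)
  define q where "q = rot \<circ> \<pi>\<^sub>1"
  have q_eq: "q a = (\<pi>\<^sub>1 a + k) mod n" if "a < n" for a
    using rotation_funpow lt1 that by (simp add: q_def rot_def)
  have per: "q permutes {..<n}"
    unfolding q_def using Dih_permutes[OF rot] per1 by (rule permutes_compose[rotated])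
  have q_p: "q p = 0"
    using q_eq[OF p(1)] lt1[OF p(1)] by (simp add: k_def)
  have q_lt: "q a < n" if "a < n" for a
    using permutes_in_image[OF per, of a] that by simp
  interpret q: circular_cells_ordering n D r p t m h q
  proof
    show "inj_on q {..<n}" using per by (rule permutes_inj_on)
    show "respects_cyclic_order n D q"
      using respects_cyclic_order_shift[OF robinson_orderings_respects(2)[OF \<pi>(1)], of k] q_eq
      unfolding respects_cyclic_order_def by simp
  qed (use q_p q_lt in auto)
  interpret \<pi>\<^sub>2: circular_cells_ordering n D r p t m h \<pi>\<^sub>2
  proof
    show "inj_on \<pi>\<^sub>2 {..<n}" using per2 by (rule permutes_inj_on)
  qed (use lt2 \<pi>(3) robinson_orderings_respects(2)[OF \<pi>(2)] in auto)
  \<comment> \<open>Agreement on good pairs confines the inversions to \<open>bad_pairs\<close>; the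
    factor \<open>n\<close> in their count cancels against \<open>n choose 2\<close>.\<close>
  have bound: "kendall_tau n f \<pi>\<^sub>2 \<le> 2 * (10 * h + 7) * K / (real n - 1)"
    if agree: "\<And>u v. u < n \<Longrightarrow> v < n \<Longrightarrow> good_pair u v \<Longrightarrow> f u < f v \<longleftrightarrow> \<pi>\<^sub>2 u < \<pi>\<^sub>2 v"
      "\<And>u v. u < n \<Longrightarrow> v < n \<Longrightarrow> good_pair u v \<Longrightarrow> f v < f u \<longleftrightarrow> \<pi>\<^sub>2 v < \<pi>\<^sub>2 u" for f
  proof -
    let ?P = "{(i, j). i < j \<and> j < n \<and> (f i < f j \<and> \<pi>\<^sub>2 i > \<pi>\<^sub>2 j \<or> f i > f j \<and> \<pi>\<^sub>2 i < \<pi>\<^sub>2 j)}"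
    have "?P \<subseteq> bad_pairs"
    proof (rule subrelI)
      fix i j assume ij: "(i, j) \<in> ?P"
      have "\<not> good_pair i j" "\<not> good_pair j i"
        using agree[of i j] agree[of j i] ij by auto
      then show "(i, j) \<in> bad_pairs"
        using ij by (simp add: bad_pairs_def)
    qed
    moreover have "finite bad_pairs"
      by (rule finite_subset[of _ "{..<n} \<times> {..<n}"]) (auto simp: bad_pairs_def)
    ultimately have "real (card ?P) \<le> n * ((10 * h + 7) * K)"
      using card_bad_pairs[OF K] card_mono by (meson of_nat_le_iff order_trans)
    then have "kendall_tau n f \<pi>\<^sub>2 \<le> n * ((10 * h + 7) * K) / (n * (real n - 1) / 2)"
      using n unfolding kendall_tau_def real_choose_two by (intro divide_right_mono) auto
    also have "\<dots> = 2 * (10 * h + 7) * K / (real n - 1)"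
      using n by (simp add: field_simps)
    finally show ?thesis .
  qed
  \<comment> \<open>This is negation modulo \<open>n\<close>: it fixes position \<open>0\<close>,
    hence \<open>p\<close>, and reverses all positive positions.\<close>
  define flip where "flip = rotation n \<circ> reflection n"
  have flip: "flip \<in> Dih n"
    by (simp add: flip_def comp_in_Dih rotation_in_Dih reflection_in_Dih)
  have flip_less: "flip a < flip b \<longleftrightarrow> b < a" if "0 < a" "a < n" "0 < b" "b < n" for a b
    using that by (auto simp: flip_def rotation_def reflection_def Suc_diff_Suc)
  have pos: "0 < q u" if "u < n" "t u \<noteq> 0" for u
    using q.q_eq_iff[OF that(1) p(1)] p(2) q_p that by (auto simp: gr0_conv_Suc intro: ccontr)
  have flip_q: "flip (q u) < flip (q v) \<longleftrightarrow> q v < q u" "flip (q v) < flip (q u) \<longleftrightarrow> q u < q v"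
    if "u < n" "v < n" "good_pair u v" for u v
  proof -
    have "t u \<noteq> 0" "t v \<noteq> 0" using that(3) h by (auto simp: good_pair_def)
    then show "flip (q u) < flip (q v) \<longleftrightarrow> q v < q u" "flip (q v) < flip (q u) \<longleftrightarrow> q u < q v"
      using flip_less pos q_lt that by auto
  qed
  show ?thesis
  proof (cases "\<forall>u<n. \<forall>v<n. good_pair u v \<longrightarrow> (q u < q v \<longleftrightarrow> \<pi>\<^sub>2 u < \<pi>\<^sub>2 v) \<and> (q v < q u \<longleftrightarrow> \<pi>\<^sub>2 v < \<pi>\<^sub>2 u)")
    case True
    then show ?thesis
      using bound[of q] rot by (auto simp: q_def intro!: bexI[of _ rot])
  next
    case False
    \<comment> \<open>Each of \<open>q\<close> and \<open>\<pi>\<^sub>2\<close> treats all good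
      pairs alike, so one disagreement means that their orientations are opposite.\<close>
    then have "\<forall>u<n. \<forall>v<n. good_pair u v \<longrightarrow> (q v < q u \<longleftrightarrow> \<pi>\<^sub>2 u < \<pi>\<^sub>2 v) \<and> (q u < q v \<longleftrightarrow> \<pi>\<^sub>2 v < \<pi>\<^sub>2 u)"
      using q.good_pair_monotone \<pi>\<^sub>2.good_pair_monotone by (meson less_asym)
    then have "kendall_tau n (flip \<circ> q) \<pi>\<^sub>2 \<le> 2 * (10 * h + 7) * K / (real n - 1)"
      using flip_q by (intro bound) auto
    then show ?thesis
      using comp_in_Dih[OF flip rot] unfolding q_def comp_assoc[symmetric] by blast
  qed
qed

section \<open>From points on the circle to cells\<close>

lemma mod_diff_cases:
  fixes a b m :: int
  assumes "0 \<le> a" "a < m" "0 \<le> b" "b < m"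
  shows "(a - b) mod m = (if b \<le> a then a - b else a - b + m)"
proof (cases "b \<le> a")
  case False
  then show ?thesis
    using assms by (intro int_mod_pos_eq[where q = "-1"]) auto
qed (use assms in auto)

text \<open>Neighbouring cells on either side of \<open>0\<close> have numbers differing by
  \<open>m - 1\<close>, whence the second alternative. Rounding costs less than one cell, so the
  scaled points are within \<open>2\<close> around the circle.\<close>

lemma near_cells:
  assumes "0 < m"
    and "\<bar>\<lfloor>real m * x\<rfloor> - \<lfloor>real m * y\<rfloor>\<bar> \<le> 1 \<or> int m - 1 \<le> \<bar>\<lfloor>real m * x\<rfloor> - \<lfloor>real m * y\<rfloor>\<bar>"
  shows "Arc x y \<le> 2 / real m"
proof -
  have "\<bar>real m * x - real m * y\<bar> < 2 \<or> \<bar>real m * x - real m * y\<bar> > real m - 2"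
    using assms(2) by linarith
  then have "real m * \<bar>x - y\<bar> < 2 \<or> real m * \<bar>x - y\<bar> > real m - 2"
    using abs_mult[of "real m" "x - y"] by (simp add: right_diff_distrib)
  then have "\<bar>x - y\<bar> \<le> 2 / real m \<or> 1 - \<bar>x - y\<bar> \<le> 2 / real m"
    using \<open>0 < m\<close> by (auto simp: field_simps)
  then show ?thesis by (auto simp: Arc_def)
qed

text \<open>Cell numbers are integers, so they differ by at least \<open>h + 1\<close> in either
  direction around the circle; rounding loses less than one.\<close>

lemma far_cells:
  assumes "0 < m"
    and "h < \<bar>\<lfloor>real m * x\<rfloor> - \<lfloor>real m * y\<rfloor>\<bar>" "\<bar>\<lfloor>real m * x\<rfloor> - \<lfloor>real m * y\<rfloor>\<bar> < int m - h"
  shows "h / real m < Arc x y"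
proof -
  have "\<bar>real m * x - real m * y\<bar> > h" "\<bar>real m * x - real m * y\<bar> < real m - h"
    using assms(2,3) by linarith+
  then have "real m * \<bar>x - y\<bar> > h" "real m * \<bar>x - y\<bar> < real m - h"
    using abs_mult[of "real m" "x - y"] by (simp_all add: right_diff_distrib)
  then show ?thesis
    using \<open>0 < m\<close> by (auto simp: field_simps Arc_def)
qed

text \<open>The radius is \<open>2 * L / m\<close>: neighbouring cells have \<open>Arc\<close> at
  most \<open>2 / m\<close>, and the upper Lipschitz bound applies. Beyond \<open>h\<close> cells
  \<open>Arc\<close> exceeds \<open>h / m\<close>, and the choice of \<open>h\<close> makes
  \<open>l * (h / m)\<close> at least this radius.\<close>

lemma diam_le_of_cells:
  fixes x :: "nat \<Rightarrow> real" and K :: real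
  assumes d: "dissimilarity_on {0..<1} d" "0 < l" "l \<le> L" "bi_lipschitz_Arc l L d"
    and x: "\<And>i. i < n \<Longrightarrow> x i \<in> {0..<1}"
    and nm: "2 \<le> n" "0 < m"
    and occupied: "\<And>j. j < m \<Longrightarrow> \<exists>i<n. \<lfloor>real m * x i\<rfloor> = int j"
    and K: "\<And>j. j < m \<Longrightarrow> real (card {i. i < n \<and> \<lfloor>real m * x i\<rfloor> = int j}) \<le> K"
  shows "diam n (robinson_orderings n (\<lambda>i j. d (x i) (x j))) \<le> 2 * (10 * \<lceil>2 * L / l\<rceil> + 7) * K / (real n - 1)"
proof -
  define D where "D = (\<lambda>i j. d (x i) (x j))"
  define c where "c i = \<lfloor>real m * x i\<rfloor>" for i
  define h where "h = \<lceil>2 * L / l\<rceil>"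
  have h: "h \<ge> 0" "2 * L / l \<le> h"
    using d by (simp_all add: h_def less_trans[of "-1" 0])
  have K0: "0 \<le> K"
    using K[OF nm(2)] by linarith
  have c: "0 \<le> c i" "c i < int m" if "i < n" for i
  proof -
    have "0 \<le> real m * x i" "real m * x i < m" using x[OF that] nm by auto
    then show "0 \<le> c i" "c i < int m" unfolding c_def by linarith+
  qed
  have cells: "circular_cells n D (2 * L / m) p (\<lambda>i. (c i - c p) mod int m) (int m) h" if p: "p < n" for p
  proof
    show "D a b = D b a" if "a < n" "b < n" for a b
      using d(1) x that by (auto simp: dissimilarity_on_def D_def)
    show "0 \<le> (c i - c p) mod int m \<and> (c i - c p) mod int m < int m" for i
      using nm by simp
    show "\<exists>i<n. (c i - c p) mod int m = s" if s: "0 \<le> s" "s < int m" for s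
    proof -
      have "nat ((s + c p) mod int m) < m" using nm by (simp add: nat_less_iff)
      then obtain i where "i < n" "c i = (s + c p) mod int m"
        using occupied[of "nat ((s + c p) mod int m)"] nm unfolding c_def by auto
      then show ?thesis
        using s by (auto intro!: exI[of _ i] simp: mod_diff_left_eq)
    qed
    show "D i j \<le> 2 * L / real m"
      if ij: "i < n" "j < n" "\<bar>(c i - c p) mod int m - (c j - c p) mod int m\<bar> \<le> 1" for i j
    proof -
      \<comment> \<open>Renumbering the cells from that of \<open>p\<close> changes a difference by
        \<open>0\<close>, \<open>m\<close> or \<open>- m\<close>, so its absolute value
        \<open>s\<close> either stays or becomes \<open>m - s\<close>.\<close>
      have "\<bar>c i - c j\<bar> \<le> 1 \<or> int m - 1 \<le> \<bar>c i - c j\<bar>"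
        using ij c[OF ij(1)] c[OF ij(2)] c[OF p] by (auto simp: mod_diff_cases split: if_splits)
      then have "Arc (x i) (x j) \<le> 2 / real m"
        using near_cells nm unfolding c_def by blast
      then have "L * Arc (x i) (x j) \<le> L * (2 / real m)"
        using d by (intro mult_left_mono) auto
      moreover have "D i j \<le> L * Arc (x i) (x j)"
        using d(4) x ij by (simp add: bi_lipschitz_Arc_def D_def)
      ultimately show ?thesis by (simp add: mult.commute)
    qed
    show "D i j > 2 * L / real m"
      if ij: "i < n" "j < n" "h < \<bar>(c i - c p) mod int m - (c j - c p) mod int m\<bar>"
        "\<bar>(c i - c p) mod int m - (c j - c p) mod int m\<bar> < int m - h" for i j
    proof -
      have "h < \<bar>c i - c j\<bar>" "\<bar>c i - c j\<bar> < int m - h"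
        using ij c[OF ij(1)] c[OF ij(2)] c[OF p] by (auto simp: mod_diff_cases split: if_splits)
      then have "h / real m < Arc (x i) (x j)"
        using far_cells nm unfolding c_def by blast
      then have "l * (h / real m) < l * Arc (x i) (x j)"
        using d by (intro mult_strict_left_mono) auto
      moreover have "l * (2 * L / l / real m) \<le> l * (h / real m)"
        using d h by (intro mult_left_mono divide_right_mono) auto
      moreover have "l * Arc (x i) (x j) \<le> D i j"
        using d(4) x ij by (simp add: bi_lipschitz_Arc_def D_def)
      ultimately show ?thesis using d by simp
    qed
  qed (use p h in auto)
  have "\<exists>\<rho>\<in>Dih n. kendall_tau n (\<rho> \<circ> \<pi>\<^sub>1) \<pi>\<^sub>2 \<le> 2 * (10 * h + 7) * K / (real n - 1)"
    if \<pi>: "\<pi>\<^sub>1 \<in> robinson_orderings n D" "\<pi>\<^sub>2 \<in> robinson_orderings n D" for \<pi>\<^sub>1 \<pi>\<^sub>2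
  proof -
    have per: "\<pi>\<^sub>2 permutes {..<n}" by (rule robinson_orderings_respects(1)[OF \<pi>(2)])
    \<comment> \<open>The origin \<open>p\<close> depends on \<open>\<pi>\<^sub>2\<close>, which is
      why \<open>cells\<close> was proved for every \<open>p\<close>.\<close>
    obtain p where first: "p < n" "\<pi>\<^sub>2 p = 0"
      using permutes_image[OF per] nm by (metis image_iff lessThan_iff less_le_trans zero_less_numeral)
    interpret circular_cells n D "2 * L / m" p "\<lambda>i. (c i - c p) mod int m" "int m" h
      by (rule cells[OF first(1)])
    have "real (card {i. i < n \<and> (c i - c p) mod int m = s}) \<le> K" if s: "0 \<le> s" "s < int m" for s
    proof -
      have "c i = (s + c p) mod int m" if "i < n" "(c i - c p) mod int m = s" for i
      proof -
        have "(s + c p) mod int m = c i mod int m"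
          unfolding that(2)[symmetric] by (simp add: mod_add_left_eq)
        then show ?thesis using c[OF that(1)] by simp
      qed
      then have "card {i. i < n \<and> (c i - c p) mod int m = s}
          \<le> card {i. i < n \<and> c i = int (nat ((s + c p) mod int m))}"
        using nm by (intro card_mono) auto
      moreover have "nat ((s + c p) mod int m) < m" using nm by (simp add: nat_less_iff)
      ultimately show ?thesis
        using K[of "nat ((s + c p) mod int m)"] unfolding c_def by linarith
    qed
    then show ?thesis
      using kendall_tau_rotated_le[OF nm(1) _ K0 \<pi> first(2)] by blast
  qed
  moreover have "0 \<le> 2 * (10 * h + 7) * K / (real n - 1)"
    using h K0 nm by auto
  ultimately show ?thesis
    unfolding D_def[symmetric] h_def[symmetric]
    by (intro diam_le) (auto simp: robinson_orderings_def)
qed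

section \<open>Occupancy of the cells by random points\<close>

lemma emeasure_space_uniform01: "emeasure uniform01 (space uniform01) = 1"
  by (simp add: uniform01_def emeasure_restrict_space)

text \<open>For \<open>a = 0\<close> the product indicates that a cell is empty, for \<open>a = exp 1\<close> it is the exponential of
  the number of points in the cell.\<close>

lemma expectation_prod_cell:
  fixes a :: real
  assumes iid: "iid_uniform01 M n x" and j: "j < m" and a: "0 \<le> a"
  shows "integrable M (\<lambda>\<omega>. \<Prod>i<n. if \<lfloor>real m * x i \<omega>\<rfloor> = int j then a else 1)"
    and "prob_space.expectation M (\<lambda>\<omega>. \<Prod>i<n. if \<lfloor>real m * x i \<omega>\<rfloor> = int j then a else 1)
      \<le> exp ((a - 1) * (real n / real m))"
proof -
  interpret prob_space M using iid by (simp add: iid_uniform01_def)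
  define cell where "cell = {real j / real m ..< (real j + 1) / real m}"
  have m: "real m > 0" using j by simp
  have cell_iff: "\<lfloor>real m * y\<rfloor> = int j \<longleftrightarrow> y \<in> cell" for y
    using m by (auto simp: cell_def floor_eq_iff field_simps)
  have sub: "cell \<subseteq> {0..<1}"
  proof -
    have "(real j + 1) / real m \<le> 1" using j by (simp add: field_simps)
    moreover have "0 \<le> real j / real m" by simp
    ultimately show ?thesis
      unfolding cell_def by (meson atLeastLessThan_iff ivl_subset less_le_trans order_trans subsetI)
  qed
  define g :: "real \<Rightarrow> real" where "g y = (if y \<in> cell then a else 1)" for y
  have g_borel: "g \<in> borel_measurable borel"
    unfolding g_def cell_def by measurable
  then have g[measurable]: "g \<in> borel_measurable uniform01"
    unfolding uniform01_def by (intro measurable_restrict_space1) simp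
  have rv: "x i \<in> measurable M uniform01" if "i < n" for i
    using iid that unfolding iid_uniform01_def indep_vars_def by auto
  have gx: "(\<lambda>\<omega>. g (x i \<omega>)) \<in> borel_measurable M" if "i < n" for i
    using measurable_compose[OF rv[OF that] g] .
  have int: "integrable M (\<lambda>\<omega>. g (x i \<omega>))" if "i < n" for i
    by (rule integrable_const_bound[where B = "max a 1"]) (use gx[OF that] a in \<open>auto simp: g_def\<close>)
  have indep: "indep_vars (\<lambda>_. borel) (\<lambda>i \<omega>. g (x i \<omega>)) {..<n}"
    by (rule indep_vars_compose2[where M' = "\<lambda>_. uniform01" and X = x])
      (use iid g in \<open>auto simp: iid_uniform01_def\<close>)
  have ev: "expectation (\<lambda>\<omega>. g (x i \<omega>)) = 1 + (a - 1) / real m" if "i < n" for i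
  proof -
    have cell_sets: "cell \<in> sets uniform01"
      using sub
      by (subst uniform01_def, subst sets_restrict_space_iff) (auto simp: cell_def)
    interpret U: prob_space uniform01 by (rule prob_spaceI) (rule emeasure_space_uniform01)
    have "measure uniform01 cell = measure lborel cell"
      unfolding uniform01_def using sub by (intro measure_restrict_space) auto
    also have "\<dots> = 1 / real m"
      using m by (simp add: cell_def measure_def divide_right_mono diff_divide_distrib[symmetric])
    finally have meas: "measure uniform01 cell = 1 / real m" .
    have "expectation (\<lambda>\<omega>. g (x i \<omega>)) = (\<integral>y. g y \<partial>distr M uniform01 (x i))"
      by (rule integral_distr[symmetric, OF rv[OF that] g])
    also have "\<dots> = (\<integral>y. g y \<partial>uniform01)"
      using iid that by (simp add: iid_uniform01_def)
    also have "\<dots> = (\<integral>y. 1 + (a - 1) * indicat_real cell y \<partial>uniform01)"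
      by (rule Bochner_Integration.integral_cong) (auto simp: g_def indicator_def)
    also have "\<dots> = 1 + (a - 1) * measure uniform01 cell"
      using cell_sets U.prob_space U.emeasure_finite
      by (simp add: sets.Int_space_eq2 less_top[symmetric])
    finally show ?thesis by (simp add: meas)
  qed
  have eq: "(\<lambda>\<omega>. \<Prod>i<n. if \<lfloor>real m * x i \<omega>\<rfloor> = int j then a else 1) = (\<lambda>\<omega>. \<Prod>i<n. g (x i \<omega>))"
    by (simp add: cell_iff g_def)
  show "integrable M (\<lambda>\<omega>. \<Prod>i<n. if \<lfloor>real m * x i \<omega>\<rfloor> = int j then a else 1)"
    unfolding eq using int indep by (intro indep_vars_integrable) auto
  have "expectation (\<lambda>\<omega>. \<Prod>i<n. g (x i \<omega>)) = (\<Prod>i<n. expectation (\<lambda>\<omega>. g (x i \<omega>)))"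
    using int indep by (intro indep_vars_lebesgue_integral) auto
  also have "\<dots> = (1 + (a - 1) / real m) ^ n" by (simp add: ev)
  \<comment> \<open>This is \<open>1 + u \<le> exp u\<close> raised to the power \<open>n\<close>;
    the base is nonnegative because \<open>0 \<le> a\<close> and \<open>1 \<le> m\<close>.\<close>
  also have "\<dots> \<le> exp ((a - 1) / real m) ^ n"
  proof (rule power_mono)
    have "1 \<le> real m" using m by simp
    then have "0 \<le> real m + (a - 1)" using a by linarith
    then show "0 \<le> 1 + (a - 1) / real m" using m by (simp add: field_simps)
  qed (rule exp_ge_add_one_self)
  also have "\<dots> = exp ((a - 1) * (real n / real m))"
    by (simp flip: exp_of_nat_mult)
  finally show "expectation (\<lambda>\<omega>. \<Prod>i<n. if \<lfloor>real m * x i \<omega>\<rfloor> = int j then a else 1)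
      \<le> exp ((a - 1) * (real n / real m))"
    unfolding eq .
qed

text \<open>A union bound and a Chernoff bound in pointwise form. An empty cell makes the first sum
  at least \<open>1\<close>, a cell with more than \<open>K\<close> points makes the second term at
  least \<open>1\<close>, and either suffices as the diameter is at most \<open>1\<close>. Otherwise
  the deterministic bound applies.\<close>

lemma diam_le_occupancy:
  fixes x :: "nat \<Rightarrow> real" and K :: real
  assumes d: "dissimilarity_on {0..<1} d" "0 < l" "l \<le> L" "bi_lipschitz_Arc l L d"
    and x: "\<And>i. i < n \<Longrightarrow> x i \<in> {0..<1}" and nm: "2 \<le> n" "0 < m" and K: "0 \<le> K"
  shows "diam n (robinson_orderings n (\<lambda>i j. d (x i) (x j)))
    \<le> (\<Sum>j<m. \<Prod>i<n. if \<lfloor>real m * x i\<rfloor> = int j then 0 else 1)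
      + (\<Sum>j<m. \<Prod>i<n. if \<lfloor>real m * x i\<rfloor> = int j then exp 1 else 1) / exp K
      + 2 * (10 * \<lceil>2 * L / l\<rceil> + 7) * K / (real n - 1)"
    (is "?diam \<le> ?W0 + ?W1 / exp K + ?B")
proof -
  have W0: "?W0 \<ge> 0" and W1: "?W1 / exp K \<ge> 0"
    by (auto intro!: sum_nonneg prod_nonneg divide_nonneg_nonneg)
  have "\<lceil>2 * L / l\<rceil> \<ge> 0"
    using d by (simp add: less_trans[of "-1" 0])
  then have B: "?B \<ge> 0"
    using K nm by auto
  have prod_exp: "(\<Prod>i<n. if \<lfloor>real m * x i\<rfloor> = int j then exp 1 else 1)
      = exp (real (card {i. i < n \<and> \<lfloor>real m * x i\<rfloor> = int j}))" for j
  proof -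
    have "(\<Prod>i<n. if \<lfloor>real m * x i\<rfloor> = int j then exp 1 else 1)
        = (\<Prod>i\<in>{i \<in> {..<n}. \<lfloor>real m * x i\<rfloor> = int j}. exp (1::real))"
      by (rule prod.inter_filter[symmetric]) simp
    also have "\<dots> = exp 1 ^ card {i \<in> {..<n}. \<lfloor>real m * x i\<rfloor> = int j}" by simp
    finally show ?thesis by (simp flip: exp_of_nat_mult)
  qed
  consider (empty) j where "j < m" "\<forall>i<n. \<lfloor>real m * x i\<rfloor> \<noteq> int j"
    | (full) j where "j < m" "real (card {i. i < n \<and> \<lfloor>real m * x i\<rfloor> = int j}) > K"
    | (typical) "\<forall>j<m. \<exists>i<n. \<lfloor>real m * x i\<rfloor> = int j"
        "\<forall>j<m. real (card {i. i < n \<and> \<lfloor>real m * x i\<rfloor> = int j}) \<le> K"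
    by (meson not_less)
  then show ?thesis
  proof cases
    case typical
    then have "?diam \<le> ?B"
      by (intro diam_le_of_cells[where x = x, OF d x nm]) auto
    then show ?thesis using W0 W1 by linarith
  next
    case empty
    have "(\<Prod>i<n. if \<lfloor>real m * x i\<rfloor> = int j then 0 else 1) \<le> ?W0"
      using empty(1) by (intro member_le_sum) (auto intro!: prod_nonneg)
    moreover have "(\<Prod>i<n. if \<lfloor>real m * x i\<rfloor> = int j then 0 else 1) = (1::real)"
      using empty(2) by (intro prod.neutral) auto
    ultimately have "1 \<le> ?W0" by simp
    then show ?thesis
      using diam_robinson_orderings_le_1 W1 B by (smt (verit, best))
  next
    case full
    have "exp K \<le> exp (real (card {i. i < n \<and> \<lfloor>real m * x i\<rfloor> = int j}))"
      using full(2) by simp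
    also have "\<dots> \<le> ?W1"
      unfolding prod_exp using full(1)
      by (intro member_le_sum[where f = "\<lambda>j. exp (real (card {i. i < n \<and> \<lfloor>real m * x i\<rfloor> = int j}))"]) auto
    finally have "1 \<le> ?W1 / exp K" by simp
    then show ?thesis
      using diam_robinson_orderings_le_1 W0 B by (smt (verit, best))
  qed
qed

lemma expectation_diam_le:
  fixes M :: "'a measure" and x :: "nat \<Rightarrow> 'a \<Rightarrow> real" and n m :: nat and K :: real
  assumes d: "dissimilarity_on {0..<1} d" "0 < l" "l \<le> L" "bi_lipschitz_Arc l L d"
    and iid: "iid_uniform01 M n x" and nm: "2 \<le> n" "0 < m" and K: "0 \<le> K"
  shows "prob_space.expectation M (\<lambda>\<omega>. diam n (robinson_orderings n (\<lambda>i j. d (x i \<omega>) (x j \<omega>))))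
    \<le> m * exp (- (n / m)) + m * exp (2 * (n / m)) / exp K + 2 * (10 * \<lceil>2 * L / l\<rceil> + 7) * K / (real n - 1)"
    (is "prob_space.expectation M ?diam \<le> _ + _ + ?B")
proof -
  interpret prob_space M using iid by (simp add: iid_uniform01_def)
  define W where "W a \<omega> = (\<Sum>j<m. \<Prod>i<n. if \<lfloor>real m * x i \<omega>\<rfloor> = int j then a else 1)" for a :: real and \<omega>
  have W_int: "integrable M (W a)" if "0 \<le> a" for a
    unfolding W_def using that by (intro Bochner_Integration.integrable_sum expectation_prod_cell(1)[OF iid]) auto
  have W_le: "expectation (W a) \<le> m * exp ((a - 1) * (n / m))" if "0 \<le> a" for a
  proof -
    have "expectation (W a) = (\<Sum>j<m. expectation (\<lambda>\<omega>. \<Prod>i<n. if \<lfloor>real m * x i \<omega>\<rfloor> = int j then a else 1))"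
      unfolding W_def using that
      by (intro Bochner_Integration.integral_sum expectation_prod_cell(1)[OF iid]) auto
    also have "\<dots> \<le> (\<Sum>j<m. exp ((a - 1) * (n / m)))"
      using that by (intro sum_mono expectation_prod_cell(2)[OF iid]) auto
    finally show ?thesis by simp
  qed
  \<comment> \<open>From \<open>exp 1 \<le> 3\<close>.\<close>
  have "m * exp ((exp 1 - 1) * (n / m)) \<le> m * exp (2 * (n / m))"
    using exp_le by (intro mult_left_mono iffD2[OF exp_le_cancel_iff] mult_right_mono) auto
  then have W1: "expectation (W (exp 1)) \<le> m * exp (2 * (n / m))"
    using W_le[of "exp 1"] by simp
  have W0: "expectation (W 0) \<le> m * exp (- (n / m))"
    using W_le[of 0] by simp
  have "\<lceil>2 * L / l\<rceil> \<ge> 0"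
    using d by (simp add: less_trans[of "-1" 0])
  then have B: "?B \<ge> 0"
    using K nm by auto
  \<comment> \<open>The diameter is not shown to be measurable: if it is not integrable, its expectation is \<open>0\<close>.\<close>
  show ?thesis
  proof (cases "integrable M ?diam")
    case True
    have "?diam \<omega> \<le> W 0 \<omega> + W (exp 1) \<omega> / exp K + ?B" if "\<omega> \<in> space M" for \<omega>
    proof -
      \<comment> \<open>This holds for every outcome, not just almost surely, because the space of
        \<open>uniform01\<close> is \<open>{0..<1}\<close>.\<close>
      have "x i \<omega> \<in> {0..<1}" if "i < n" for i
      proof -
        have "x i \<in> measurable M uniform01"
          using iid \<open>i < n\<close> unfolding iid_uniform01_def indep_vars_def by auto
        from measurable_space[OF this \<open>\<omega> \<in> space M\<close>] show ?thesis
          by (simp add: uniform01_def)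
      qed
      then show ?thesis
        unfolding W_def by (rule diam_le_occupancy[OF d _ nm K])
    qed
    then have "expectation ?diam \<le> expectation (\<lambda>\<omega>. W 0 \<omega> + W (exp 1) \<omega> / exp K + ?B)"
      using True W_int by (intro integral_mono) auto
    also have "\<dots> = expectation (W 0) + expectation (W (exp 1)) / exp K + ?B"
      using W_int prob_space by simp
    also have "\<dots> \<le> m * exp (- (n / m)) + m * exp (2 * (n / m)) / exp K + ?B"
      using W0 W1 by (intro add_right_mono add_mono divide_right_mono) auto
    finally show ?thesis .
  next
    case False
    then have "expectation ?diam = 0" by (rule not_integrable_integral_eq)
    then show ?thesis using B by (simp add: add_nonneg_nonneg)
  qed
qed

section \<open>Choice of the parameters and the final estimate\<close>

theorem theorem6p6:
  "\<exists>C>0. \<exists>N::nat. \<forall>(d :: real \<Rightarrow> real \<Rightarrow> real) (l :: real) (L :: real).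
     dissimilarity_on {0..<1} d \<and> continuous_on_circle d \<and> strict_circular_robinson d \<and>
     0 < l \<and> l \<le> L \<and> bi_lipschitz_Arc l L d \<longrightarrow>
     (\<forall>n\<ge>N. \<forall>(M :: 'a measure) (x :: nat \<Rightarrow> 'a \<Rightarrow> real).
        iid_uniform01 M n x \<longrightarrow>
        prob_space.expectation M
          (\<lambda>\<omega>. diam n (robinson_orderings n (\<lambda>i j. d (x i \<omega>) (x j \<omega>))))
        \<le> C * ((L + l) / l * (ln (real n) / real n)))"
proof (intro exI[of _ "801 :: real"] exI[of _ "3 :: nat"] conjI allI impI)
  fix d :: "real \<Rightarrow> real \<Rightarrow> real" and l L :: real and n :: nat and M :: "'a measure" and x :: "nat \<Rightarrow> 'a \<Rightarrow> real"
  assume d: "dissimilarity_on {0..<1} d \<and> continuous_on_circle d \<and> strict_circular_robinson d \<and>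
     0 < l \<and> l \<le> L \<and> bi_lipschitz_Arc l L d" and n: "3 \<le> n" and iid: "iid_uniform01 M n x"
  have ln1: "1 \<le> ln n"
    using n exp_le by (subst ln_ge_iff) auto
  have "ln (n / 2) \<le> n / 2 - 1" "ln 2 \<le> (1 :: real)"
    using n by (auto intro: ln_le_minus_one ln_2_less_1[THEN less_imp_le])
  then have ln2: "2 * ln n \<le> n"
    using n by (simp add: ln_div)
  \<comment> \<open>A cell is expected to hold \<open>n / m\<close> points, between
    \<open>2 * ln n\<close> and \<open>4 * ln n\<close>: enough to make empty cells unlikely
    (\<open>T1\<close>), few enough to make overfull ones unlikely (\<open>T2\<close>).\<close>
  define m where "m = nat \<lfloor>n / (2 * ln n)\<rfloor>"
  have 1: "1 \<le> n / (2 * ln n)" using ln1 ln2 by simp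
  then have m1: "real m \<le> n / (2 * ln n)" "n / (2 * ln n) < real m + 1" "1 \<le> m"
    unfolding m_def by linarith+
  have ratio: "2 * ln n \<le> n / m" "n / m \<le> 4 * ln n"
  proof -
    show "2 * ln n \<le> n / m" using m1 ln1 by (simp add: field_simps)
    have "n / (2 * ln n) \<le> 2 * real m" using m1 by linarith
    then show "n / m \<le> 4 * ln n" using m1 ln1 by (simp add: field_simps)
  qed
  have "n / (2 * ln n) \<le> n / 1"
    using ln1 n by (intro divide_left_mono) auto
  then have mn: "real m \<le> n" using m1 by simp
  have E: "exp (k * ln n) = real n ^ k" for k :: nat
    using n by (simp add: exp_of_nat_mult)
  have T1: "m * exp (- (n / m)) \<le> 1 / n"
  proof -
    have "exp (- (n / m)) \<le> exp (- (2 * ln n))" using ratio by simp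
    also have "\<dots> = 1 / real n ^ 2" using E[of 2] by (simp add: exp_minus field_simps)
    finally have "m * exp (- (n / m)) \<le> n * (1 / real n ^ 2)" using mn by (intro mult_mono) auto
    then show ?thesis using n by (simp add: power2_eq_square)
  qed
  \<comment> \<open>The threshold is \<open>K = 10 * ln n\<close>: the exponential moment is at most
    \<open>n ^ 8\<close>, the union bound over cells costs another \<open>n\<close>, and
    \<open>exp K = n ^ 10\<close> leaves \<open>1 / n\<close>.\<close>
  have T2: "m * exp (2 * (n / m)) / exp (10 * ln n) \<le> 1 / n"
  proof -
    have "exp (2 * (n / m)) \<le> exp (8 * ln n)" using ratio by simp
    also have "\<dots> = real n ^ 8" using E[of 8] by simp
    finally have "m * exp (2 * (n / m)) / exp (10 * ln n) \<le> n * real n ^ 8 / real n ^ 10"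
      using mn n E[of 10] by (intro frac_le mult_mono) auto
    also have "\<dots> = 1 / n" using n by (simp add: eval_nat_numeral)
    finally show ?thesis .
  qed
  have r2: "2 \<le> (L + l) / l" using d by (simp add: field_simps)
  have h: "10 * \<lceil>2 * L / l\<rceil> + 7 \<le> 20 * ((L + l) / l)"
  proof -
    have "real_of_int \<lceil>2 * L / l\<rceil> \<le> 2 * L / l + 1" by linarith
    then have "10 * real_of_int \<lceil>2 * L / l\<rceil> + 7 \<le> 10 * (2 * L / l + 1) + 7"
      by (intro add_right_mono mult_left_mono) auto
    also have "\<dots> \<le> 20 * ((L + l) / l)" using d by (simp add: field_simps)
    finally show ?thesis by simp
  qed
  \<comment> \<open>The constant is \<open>2 * 20 * 10 * 2\<close>, with the last factor from
    \<open>n - 1 \<ge> n / 2\<close>.\<close>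
  have T3: "2 * (10 * \<lceil>2 * L / l\<rceil> + 7) * (10 * ln n) / (real n - 1) \<le> 800 * ((L + l) / l * (ln n / n))"
  proof -
    define R where "R = (L + l) / l"
    have "2 * (10 * \<lceil>2 * L / l\<rceil> + 7) \<le> 40 * R" "0 \<le> R"
      using h r2 unfolding R_def[symmetric] by simp_all
    then have "2 * (10 * \<lceil>2 * L / l\<rceil> + 7) * (10 * ln n) / (real n - 1) \<le> 40 * R * (10 * ln n) / (n / 2)"
      using ln1 n by (intro frac_le mult_right_mono) auto
    also have "\<dots> = 800 * (R * (ln n / n))"
      using n by simp
    finally show ?thesis unfolding R_def .
  qed
  have "1 / n + 1 / n \<le> 2 * (ln n / n)"
    using ln1 n by (simp add: field_simps)
  \<comment> \<open>Since \<open>l \<le> L\<close>, the factor \<open>(L + l) / l\<close> is at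
    least \<open>2\<close>; this absorbs both terms \<open>1 / n\<close> and raises the constant
    from \<open>800\<close> to \<open>801\<close>.\<close>
  also have "\<dots> \<le> (L + l) / l * (ln n / n)"
    using r2 ln1 by (intro mult_right_mono) auto
  finally have T4: "1 / n + 1 / n \<le> (L + l) / l * (ln n / n)" .
  have "prob_space.expectation M (\<lambda>\<omega>. diam n (robinson_orderings n (\<lambda>i j. d (x i \<omega>) (x j \<omega>))))
    \<le> m * exp (- (n / m)) + m * exp (2 * (n / m)) / exp (10 * ln n)
      + 2 * (10 * \<lceil>2 * L / l\<rceil> + 7) * (10 * ln n) / (real n - 1)"
    using d n m1 ln1 by (intro expectation_diam_le[OF _ _ _ _ iid]) auto
  also have "\<dots> \<le> 1 / n + 1 / n + 800 * ((L + l) / l * (ln n / n))"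
    by (intro add_mono T1 T2 T3)
  also have "\<dots> \<le> (L + l) / l * (ln n / n) + 800 * ((L + l) / l * (ln n / n))"
    using T4 by (rule add_right_mono)
  also have "\<dots> = 801 * ((L + l) / l * (ln n / n))"
    by simp
  finally show "prob_space.expectation M (\<lambda>\<omega>. diam n (robinson_orderings n (\<lambda>i j. d (x i \<omega>) (x j \<omega>))))
    \<le> 801 * ((L + l) / l * (ln (real n) / real n))" .
qed simp

end
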